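(* Let $G$ be a distinguishing critical graph. Then $\operatorname{Aut}(G)$ acts transitively on the vertex set $V(G)$.
   Context: Graphs are finite and simple. For a graph $G$, an $r$-distinguishing labeling is a function $\phi: V(G)\to\{1,2,\ldots,r\}$ such that the only $f\in\operatorname{Aut}(G)$ preserving the labels (i.e. $\phi(f(v))=\phi(v)$ for all $v\in V(G)$) is the identity. The distinguishing number $D(G)$ is the smallest $r$ for which an $r$-distinguishing labeling of $G$ exists. For an induced subgraph $H$ of $G$, $D(H)$ is computed with respect to $\operatorname{Aut}(H)$. A graph $G$ (with at least one vertex) is called distinguishing critical if $D(H)\neq D(G)$ for every proper induced subgraph $H$ of $G$ with at least one vertex. *)

theory Defs
  imports "Graph_Theory.Pair_Digraph" "Graph_Theory.Digraph_Component" "HOL-Algebra.Group_Action"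
begin

text \<open>
  A finite simple graph is a \<open>pair_graph\<close>: a finite, irreflexive, symmetric
  digraph without parallel arcs, so that an edge \<open>uv\<close> is the pair of arcs \<open>(u, v)\<close>, \<open>(v, u)\<close>.
\<close>

text \<open>
  Automorphisms are bijections of the vertex set, normalised as in \<open>Bij\<close> to be \<open>undefined\<close>
  outside it; the identity automorphism is \<open>\<lambda>v\<in>pverts G. v\<close>.
\<close>

definition graph_auts :: "'a pair_pre_digraph \<Rightarrow> ('a \<Rightarrow> 'a) set" where
  "graph_auts G = {f \<in> Bij (pverts G).
     \<forall>u\<in>pverts G. \<forall>v\<in>pverts G. (f u, f v) \<in> parcs G \<longleftrightarrow> (u, v) \<in> parcs G}"

definition Aut :: "'a pair_pre_digraph \<Rightarrow> ('a \<Rightarrow> 'a) monoid" where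
  "Aut G = BijGroup (pverts G) \<lparr>carrier := graph_auts G\<rparr>"

definition distinguishing_labeling :: "'a pair_pre_digraph \<Rightarrow> nat \<Rightarrow> ('a \<Rightarrow> nat) \<Rightarrow> bool" where
  "distinguishing_labeling G r \<phi> \<longleftrightarrow>
     \<phi> \<in> pverts G \<rightarrow> {1..r} \<and>
     (\<forall>f\<in>carrier (Aut G). (\<forall>v\<in>pverts G. \<phi> (f v) = \<phi> v) \<longrightarrow> f = \<one>\<^bsub>Aut G\<^esub>)"

definition distinguishing_number :: "'a pair_pre_digraph \<Rightarrow> nat" where
  "distinguishing_number G = (LEAST r. \<exists>\<phi>. distinguishing_labeling G r \<phi>)"

definition distinguishing_critical :: "'a pair_pre_digraph \<Rightarrow> bool" where
  "distinguishing_critical G \<longleftrightarrow>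
     pverts G \<noteq> {} \<and>
     (\<forall>H. induced_subgraph (with_proj H) (with_proj G) \<and> pverts H \<noteq> {} \<and> pverts H \<subset> pverts G
        \<longrightarrow> distinguishing_number H \<noteq> distinguishing_number G)"

end

theory Submission
  imports Defs
begin

text \<open>
  If \<open>A\<close> is a union of orbits of \<open>Aut G\<close>, gluing distinguishing labelings of the graphs induced
  on \<open>A\<close> and on its complement distinguishes \<open>G\<close>; so in the intransitive case some proper induced
  subgraph has distinguishing number at least that of \<open>G\<close>. Deleting a vertex lowers the
  distinguishing number by at most one (give that vertex a fresh label), so deleting
  further vertices down to a single one meets the distinguishing number of \<open>G\<close> exactly.
\<close>

section \<open>Automorphisms\<close>

lemma graph_auts_bij_betw: "f \<in> graph_auts G \<Longrightarrow> bij_betw f (pverts G) (pverts G)"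
  by (auto simp: graph_auts_def Bij_def)

lemma graph_auts_in_verts: "\<lbrakk>f \<in> graph_auts G; v \<in> pverts G\<rbrakk> \<Longrightarrow> f v \<in> pverts G"
  using graph_auts_bij_betw bij_betwE by metis

lemma subgroup_graph_auts: "subgroup (graph_auts G) (BijGroup (pverts G))"
proof (rule subgroup.intro)
  show "graph_auts G \<subseteq> carrier (BijGroup (pverts G))"
    by (auto simp: graph_auts_def BijGroup_def)
next
  fix f g assume fg: "f \<in> graph_auts G" "g \<in> graph_auts G"
  then have "compose (pverts G) f g \<in> graph_auts G"
    using graph_auts_in_verts[OF fg(2)]
    by (auto simp: graph_auts_def compose_eq compose_Bij)
  then show "f \<otimes>\<^bsub>BijGroup (pverts G)\<^esub> g \<in> graph_auts G"
    using fg by (simp add: BijGroup_def graph_auts_def)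
next
  show "\<one>\<^bsub>BijGroup (pverts G)\<^esub> \<in> graph_auts G"
    by (simp add: BijGroup_def graph_auts_def id_Bij)
next
  fix f assume f: "f \<in> graph_auts G"
  then have B: "f \<in> Bij (pverts G)"
    by (simp add: graph_auts_def)
  let ?g = "\<lambda>x\<in>pverts G. inv_into (pverts G) f x"
  have "?g \<in> graph_auts G"
    unfolding graph_auts_def
  proof (intro CollectI conjI ballI)
    show "?g \<in> Bij (pverts G)"
      using B by (rule restrict_inv_into_Bij)
  next
    fix u v assume uv: "u \<in> pverts G" "v \<in> pverts G"
    have mem: "?g u \<in> pverts G" "?g v \<in> pverts G"
      using uv B by (auto simp: Bij_inv_into_mem)
    \<comment> \<open>The adjacency equivalence for \<open>f\<close>, read at the preimages
      \<open>?g u\<close> and \<open>?g v\<close>, is the one required of the inverse.\<close>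
    have "f (?g u) = u" "f (?g v) = v"
      using uv bij_betw_inv_into_right[OF graph_auts_bij_betw[OF f]] by auto
    moreover have "(f (?g u), f (?g v)) \<in> parcs G \<longleftrightarrow> (?g u, ?g v) \<in> parcs G"
      using f mem unfolding graph_auts_def by blast
    ultimately show "(?g u, ?g v) \<in> parcs G \<longleftrightarrow> (u, v) \<in> parcs G"
      by simp
  qed
  then show "inv\<^bsub>BijGroup (pverts G)\<^esub> f \<in> graph_auts G"
    by (simp add: inv_BijGroup[OF B])
qed

lemma carrier_Aut [simp]: "carrier (Aut G) = graph_auts G"
  by (simp add: Aut_def)

lemma one_Aut: "\<one>\<^bsub>Aut G\<^esub> = (\<lambda>v\<in>pverts G. v)"
  by (simp add: Aut_def BijGroup_def)

lemma group_Aut: "group (Aut G)"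
  unfolding Aut_def
  by (rule subgroup.subgroup_is_group[OF subgroup_graph_auts group_BijGroup])

text \<open>Automorphisms already are elements of \<open>BijGroup (pverts G)\<close>, so the action
  homomorphism is the inclusion of a subgroup.\<close>

lemma group_action_Aut: "group_action (Aut G) (pverts G) (\<lambda>f. f)"
proof (intro group_action.intro group_hom.intro group_hom_axioms.intro group_Aut group_BijGroup)
  show "(\<lambda>f. f) \<in> hom (Aut G) (BijGroup (pverts G))"
    using subgroup.subset[OF subgroup_graph_auts, of G]
    by (auto simp: hom_def Aut_def)
qed

section \<open>Induced subgraphs\<close>

definition induced_on :: "'a pair_pre_digraph \<Rightarrow> 'a set \<Rightarrow> 'a pair_pre_digraph" where
  "induced_on G S = \<lparr>pverts = S, parcs = parcs G \<inter> S \<times> S\<rparr>"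

lemma pverts_induced_on [simp]: "pverts (induced_on G S) = S"
  by (simp add: induced_on_def)

lemma induced_on_induced_on: "T \<subseteq> S \<Longrightarrow> induced_on (induced_on G S) T = induced_on G T"
  by (auto simp: induced_on_def)

lemma induced_subgraph_induced_on:
  assumes "pair_wf_digraph G" "S \<subseteq> pverts G"
  shows "induced_subgraph (with_proj (induced_on G S)) (with_proj G)"
proof -
  have "wf_digraph (with_proj (induced_on G S))" "wf_digraph (with_proj G)"
    using assms by (auto simp: wf_digraph_wp_iff pair_wf_digraph_def induced_on_def)
  then show ?thesis
    using assms(2)
    by (auto simp: induced_subgraph_def subgraph_def compatible_def induced_on_def)
qed

text \<open>Since \<open>f\<close> maps \<open>S\<close> onto itself, it permutes \<open>S\<close>;
  applying \<open>restrict\<close> renormalises it to be \<open>undefined\<close> outside the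
  smaller vertex set.\<close>

lemma restrict_in_graph_auts_induced_on:
  assumes "f \<in> graph_auts G" "S \<subseteq> pverts G" "f ` S = S"
  shows "restrict f S \<in> graph_auts (induced_on G S)"
proof -
  have "bij_betw f S S"
    using assms graph_auts_bij_betw[OF assms(1)] by (metis bij_betw_subset)
  then have "bij_betw (restrict f S) S S"
    by (simp cong: bij_betw_cong)
  moreover have "(f u, f v) \<in> parcs G \<inter> S \<times> S \<longleftrightarrow> (u, v) \<in> parcs G \<inter> S \<times> S"
    if "u \<in> S" "v \<in> S" for u v
    using that assms by (auto simp: graph_auts_def)
  ultimately show ?thesis
    by (auto simp: graph_auts_def Bij_def induced_on_def)
qed

section \<open>Distinguishing numbers\<close>

text \<open>Automorphisms are extensional on the vertex set, so being the identity of the group can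
  be tested vertex by vertex.\<close>

lemma distinguishing_labeling_iff:
  "distinguishing_labeling G r \<phi> \<longleftrightarrow>
     \<phi> \<in> pverts G \<rightarrow> {1..r} \<and>
     (\<forall>f\<in>graph_auts G. (\<forall>v\<in>pverts G. \<phi> (f v) = \<phi> v) \<longrightarrow> (\<forall>v\<in>pverts G. f v = v))"
proof -
  have "f = (\<lambda>v\<in>pverts G. v) \<longleftrightarrow> (\<forall>v\<in>pverts G. f v = v)" if "f \<in> graph_auts G" for f
    using that by (auto simp: graph_auts_def Bij_def extensional_def fun_eq_iff)
  then show ?thesis
    unfolding distinguishing_labeling_def carrier_Aut one_Aut by blast
qed

lemma distinguishing_labeling_mono:
  "\<lbrakk>distinguishing_labeling G r \<phi>; r \<le> s\<rbrakk> \<Longrightarrow> distinguishing_labeling G s \<phi>"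
  by (fastforce simp: distinguishing_labeling_def)

lemma distinguishing_number_le:
  "distinguishing_labeling G r \<phi> \<Longrightarrow> distinguishing_number G \<le> r"
  unfolding distinguishing_number_def by (rule Least_le) blast

lemma distinguishing_labeling_exists:
  assumes "finite (pverts G)"
  obtains \<phi> where "distinguishing_labeling G (distinguishing_number G) \<phi>"
proof -
  obtain h where h: "bij_betw h (pverts G) {1..card (pverts G)}"
    using finite_same_card_bij[OF assms, of "{1..card (pverts G)}"] by auto
  \<comment> \<open>Pairwise distinct labels force every label-preserving map to fix each vertex;
    hence the set under \<open>LEAST\<close> is inhabited.\<close>
  have "distinguishing_labeling G (card (pverts G)) h"
    unfolding distinguishing_labeling_iff
    using h bij_betwE[OF h] bij_betw_imp_inj_on[OF h]
    by (auto dest: inj_onD graph_auts_in_verts)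
  then have "\<exists>\<phi>. distinguishing_labeling G (distinguishing_number G) \<phi>"
    unfolding distinguishing_number_def
    by (rule LeastI[of "\<lambda>r. \<exists>\<phi>. distinguishing_labeling G r \<phi>", OF exI])
  then show thesis
    using that by blast
qed

lemma distinguishing_number_pos:
  assumes "finite (pverts G)" "pverts G \<noteq> {}"
  shows "1 \<le> distinguishing_number G"
proof -
  obtain \<phi> where "distinguishing_labeling G (distinguishing_number G) \<phi>"
    using distinguishing_labeling_exists[OF assms(1)] .
  moreover obtain v where "v \<in> pverts G"
    using assms(2) by blast
  ultimately have "\<phi> v \<in> {1..distinguishing_number G}"
    by (auto simp: distinguishing_labeling_iff)
  then show ?thesis
    by simp
qed

lemma distinguishing_number_singleton:
  assumes "pverts G = {v}"
  shows "distinguishing_number G \<le> 1"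
proof (rule distinguishing_number_le)
  show "distinguishing_labeling G 1 (\<lambda>_. 1)"
    using graph_auts_in_verts[of _ G] by (simp add: distinguishing_labeling_iff assms)
qed

section \<open>Comparing a graph with its induced subgraphs\<close>

text \<open>The restriction of \<open>f\<close> to \<open>S\<close> is a label-preserving
  automorphism of the induced subgraph, hence trivial there. This is how labelings of pieces
  constrain automorphisms of \<open>G\<close>.\<close>

lemma distinguishing_labeling_induced_on_fixes:
  assumes "distinguishing_labeling (induced_on G S) r \<phi>"
    and "f \<in> graph_auts G" "S \<subseteq> pverts G" "f ` S = S" "\<And>v. v \<in> S \<Longrightarrow> \<phi> (f v) = \<phi> v" "v \<in> S"
  shows "f v = v"
  using assms restrict_in_graph_auts_induced_on[OF assms(2-4)]
  by (force simp: distinguishing_labeling_iff)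

lemma distinguishing_number_induced_on_diff_singleton:
  assumes fin: "finite (pverts G)" and v: "v \<in> pverts G"
  shows "distinguishing_number G \<le> Suc (distinguishing_number (induced_on G (pverts G - {v})))"
    (is "_ \<le> Suc ?d")
proof -
  let ?S = "pverts G - {v}"
  obtain \<phi> where \<phi>: "distinguishing_labeling (induced_on G ?S) ?d \<phi>"
    using distinguishing_labeling_exists[of "induced_on G ?S"] fin by auto
  then have range: "\<phi> u \<in> {1..?d}" if "u \<in> ?S" for u
    using that by (auto simp: distinguishing_labeling_iff)
  \<comment> \<open>\<open>Suc ?d\<close> is fresh, as \<open>\<phi>\<close> uses only labels up to
    \<open>?d\<close> on \<open>?S\<close>. So \<open>v\<close> is the only vertex with its label
    and must be fixed, and the remaining vertices are permuted among themselves.\<close>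
  let ?\<psi> = "\<phi>(v := Suc ?d)"
  have "f u = u" if f: "f \<in> graph_auts G" and pres: "\<forall>u\<in>pverts G. ?\<psi> (f u) = ?\<psi> u"
    and u: "u \<in> pverts G" for f u
  proof -
    have fv: "f v = v"
    proof (rule ccontr)
      assume ne: "f v \<noteq> v"
      then have "f v \<in> ?S"
        using graph_auts_in_verts[OF f v] by blast
      with range[of "f v"] pres v ne show False
        by fastforce
    qed
    have bij: "bij_betw f (pverts G) (pverts G)"
      using f by (rule graph_auts_bij_betw)
    have im: "f ` ?S = ?S"
      using bij v fv by (auto simp: bij_betw_def inj_on_image_set_diff[of f "pverts G"])
    have "\<phi> (f w) = \<phi> w" if "w \<in> ?S" for w
    proof -
      have "f w \<in> ?S"
        using im that by blast
      moreover have "?\<psi> (f w) = ?\<psi> w"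
        using pres that by blast
      ultimately show ?thesis
        using that by simp
    qed
    then show ?thesis
      using distinguishing_labeling_induced_on_fixes[OF \<phi> f _ im] u fv by (cases "u = v") auto
  qed
  moreover have "?\<psi> \<in> pverts G \<rightarrow> {1..Suc ?d}"
    using range by fastforce
  ultimately have "distinguishing_labeling G (Suc ?d) ?\<psi>"
    unfolding distinguishing_labeling_iff by blast
  then show ?thesis
    by (rule distinguishing_number_le)
qed

text \<open>No automorphism moves a vertex between \<open>A\<close> and its complement, so both
  parts may reuse the same labels: the bound is a maximum and not a sum.\<close>

lemma distinguishing_number_le_max_invariant:
  assumes fin: "finite (pverts G)" and A: "A \<subseteq> pverts G"
    and inv: "\<And>f. f \<in> graph_auts G \<Longrightarrow> f ` A \<subseteq> A"
  shows "distinguishing_number G \<le>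
    max (distinguishing_number (induced_on G A))
        (distinguishing_number (induced_on G (pverts G - A)))" (is "_ \<le> ?m")
proof -
  let ?B = "pverts G - A"
  have "finite A"
    using A fin by (rule finite_subset)
  obtain \<alpha> where "distinguishing_labeling (induced_on G A)
      (distinguishing_number (induced_on G A)) \<alpha>"
    using distinguishing_labeling_exists[of "induced_on G A"] \<open>finite A\<close> by auto
  \<comment> \<open>Both labelings are regarded as using the common palette of \<open>?m\<close>
    labels before they are glued.\<close>
  then have \<alpha>: "distinguishing_labeling (induced_on G A) ?m \<alpha>"
    by (rule distinguishing_labeling_mono) simp
  obtain \<beta> where "distinguishing_labeling (induced_on G ?B)
      (distinguishing_number (induced_on G ?B)) \<beta>"
    using distinguishing_labeling_exists[of "induced_on G ?B"] fin by auto
  then have \<beta>: "distinguishing_labeling (induced_on G ?B) ?m \<beta>"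
    by (rule distinguishing_labeling_mono) simp
  define \<phi> where "\<phi> v = (if v \<in> A then \<alpha> v else \<beta> v)" for v
  have "f v = v" if f: "f \<in> graph_auts G" and pres: "\<forall>v\<in>pverts G. \<phi> (f v) = \<phi> v"
    and v: "v \<in> pverts G" for f v
  proof -
    have bij: "bij_betw f (pverts G) (pverts G)"
      using f by (rule graph_auts_bij_betw)
    \<comment> \<open>An injective self-map of a finite set is onto, which upgrades the assumed
      inclusion to equality and makes the complement invariant too.\<close>
    then have "inj_on f A"
      using A inj_on_subset by (auto simp: bij_betw_def)
    then have imA: "f ` A = A"
      using endo_inj_surj[OF \<open>finite A\<close> inv[OF f]] by blast
    have imB: "f ` ?B = ?B"
      using bij A imA by (auto simp: bij_betw_def inj_on_image_set_diff[of f "pverts G"])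
    have a: "\<alpha> (f w) = \<alpha> w" if "w \<in> A" for w
    proof -
      have "f w \<in> A"
        using imA that by blast
      moreover have "\<phi> (f w) = \<phi> w"
        using pres that A by blast
      ultimately show ?thesis
        using that by (simp add: \<phi>_def)
    qed
    have b: "\<beta> (f w) = \<beta> w" if "w \<in> ?B" for w
    proof -
      have "f w \<in> ?B"
        using imB that by blast
      moreover have "\<phi> (f w) = \<phi> w"
        using pres that by blast
      ultimately show ?thesis
        using that by (simp add: \<phi>_def)
    qed
    show ?thesis
    proof (cases "v \<in> A")
      case True
      then show ?thesis
        using distinguishing_labeling_induced_on_fixes[OF \<alpha> f A imA a] by blast
    next
      case False
      then show ?thesis
        using distinguishing_labeling_induced_on_fixes[OF \<beta> f _ imB b] v by blast
    qed
  qed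
  moreover have "\<phi> \<in> pverts G \<rightarrow> {1..?m}"
    using \<alpha> \<beta> unfolding distinguishing_labeling_iff pverts_induced_on Pi_iff \<phi>_def by simp
  ultimately have "distinguishing_labeling G ?m \<phi>"
    unfolding distinguishing_labeling_iff by blast
  then show ?thesis
    by (rule distinguishing_number_le)
qed

text \<open>A discrete intermediate value argument: building \<open>S\<close> up vertex by vertex
  from a singleton, of distinguishing number at most 1, never raises the number by more than one, so
  no value from 1 up to the final one is skipped.\<close>

lemma distinguishing_number_intermediate:
  assumes "finite S" "S \<noteq> {}" "1 \<le> d" "d \<le> distinguishing_number (induced_on G S)"
  shows "\<exists>T\<subseteq>S. T \<noteq> {} \<and> distinguishing_number (induced_on G T) = d"
  using assms
proof (induction rule: finite_ne_induct)
  case (singleton v)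
  then have "distinguishing_number (induced_on G {v}) = d"
    using distinguishing_number_singleton[of "induced_on G {v}" v] by simp
  then show ?case
    by blast
next
  case (insert v S)
  show ?case
  proof (cases "d \<le> distinguishing_number (induced_on G S)")
    case True
    then show ?thesis
      using insert by blast
  next
    case False
    \<comment> \<open>As \<open>v\<close> is not in \<open>S\<close>, deleting it from
      \<open>insert v S\<close> leaves \<open>S\<close>. The number for \<open>S\<close> is below
      \<open>d\<close>, so this bound leaves \<open>d\<close> as the only possible value for
      \<open>insert v S\<close>.\<close>
    have "distinguishing_number (induced_on G (insert v S))
        \<le> Suc (distinguishing_number (induced_on G S))"
      using distinguishing_number_induced_on_diff_singleton[of "induced_on G (insert v S)" v]
        insert.hyps
      by (simp add: induced_on_induced_on subset_insertI)
    then have "distinguishing_number (induced_on G (insert v S)) = d"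
      using False insert.prems by simp
    then show ?thesis
      by blast
  qed
qed

section \<open>Criticality and transitivity\<close>

text \<open>Criticality itself only excludes equality. A larger value on \<open>S\<close> is
  excluded as well, because the value for \<open>G\<close> would then be attained on some nonempty
  subset of \<open>S\<close>, which is still proper in \<open>G\<close>.\<close>

lemma distinguishing_critical_induced_on_less:
  assumes "pair_wf_digraph G" "finite (pverts G)" "distinguishing_critical G"
    and "S \<subset> pverts G" "S \<noteq> {}"
  shows "distinguishing_number (induced_on G S) < distinguishing_number G"
proof (rule ccontr)
  assume "\<not> ?thesis"
  moreover have "1 \<le> distinguishing_number G"
    using assms by (intro distinguishing_number_pos) auto
  moreover have "finite S"
    using assms by (meson finite_subset psubset_imp_subset)
  ultimately obtain T where T: "T \<subseteq> S" "T \<noteq> {}"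
    "distinguishing_number (induced_on G T) = distinguishing_number G"
    using distinguishing_number_intermediate[of S "distinguishing_number G" G] assms(5) by auto
  then have "T \<subset> pverts G"
    using assms(4) by blast
  then show False
    using assms(3) T induced_subgraph_induced_on[OF assms(1), of T]
    unfolding distinguishing_critical_def by (metis psubset_imp_subset pverts_induced_on)
qed

theorem theorem2p2:
  fixes G :: "'a pair_pre_digraph"
  assumes "pair_graph G"
    and "distinguishing_critical G"
  shows "transitive_action (Aut G) (pverts G) (\<lambda>f. f)"
proof -
  interpret pair_graph G
    by fact
  interpret act: group_action "Aut G" "pverts G" "\<lambda>f. f"
    by (rule group_action_Aut)
  have wf: "pair_wf_digraph G"
    by unfold_locales
  have fin: "finite (pverts G)"
    by (rule pair_finite_verts)
  have "\<exists>f\<in>carrier (Aut G). f x = y" if x: "x \<in> pverts G" and y: "y \<in> pverts G" for x y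
  proof (rule ccontr)
    assume no: "\<not> ?thesis"
    \<comment> \<open>The orbit of \<open>x\<close> contains \<open>x\<close> but misses
      \<open>y\<close>, so it and its complement are both nonempty proper vertex sets, to which
      criticality applies.\<close>
    let ?A = "orbit (Aut G) (\<lambda>f. f) x"
    have A: "?A \<subseteq> pverts G"
      using x by (auto simp: orbit_def dest: graph_auts_in_verts)
    have xA: "x \<in> ?A"
      using x by (rule act.orbit_refl)
    have yA: "y \<notin> ?A"
      using no by (auto simp: orbit_def)
    have "f v \<in> ?A" if f: "f \<in> graph_auts G" and v: "v \<in> ?A" for f v
    proof (rule act.orbit_trans[OF x _ _ v])
      show "v \<in> pverts G" "f v \<in> pverts G"
        using A v f by (auto dest: graph_auts_in_verts)
      show "f v \<in> orbit (Aut G) (\<lambda>f. f) v"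
        using f by (auto simp: orbit_def)
    qed
    \<comment> \<open>The orbit is invariant, so the gluing bound holds; yet both terms of the
      maximum lie strictly below the left-hand side.\<close>
    then have "distinguishing_number G \<le>
      max (distinguishing_number (induced_on G ?A))
          (distinguishing_number (induced_on G (pverts G - ?A)))"
      by (intro distinguishing_number_le_max_invariant fin A) auto
    moreover have "distinguishing_number (induced_on G ?A) < distinguishing_number G"
      using A xA yA y
      by (intro distinguishing_critical_induced_on_less wf fin assms(2)) auto
    moreover have "distinguishing_number (induced_on G (pverts G - ?A)) < distinguishing_number G"
      using A xA yA y x
      by (intro distinguishing_critical_induced_on_less wf fin assms(2)) auto
    ultimately show False
      by simp
  qed
  then show ?thesis
    by (intro transitive_action.intro transitive_action_axioms.intro group_action_Aut)
qed

end
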